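(* Let $f:\mathbb{R}^n\to\mathbb{R}\cup\{\infty\}$ be invariant under the natural action of a Lie subgroup $G$ of $\mathrm{GL}(n,\mathbb{R})$ (i.e. $f(gx)=f(x)$ for all $g\in G$, $x\in\mathbb{R}^n$), and let $C(x)=P_{\mathrm{s}(\mathfrak{g})}(xx^T)$ for $x\in\mathbb{R}^n$. Fix $\overline{x}\in\mathrm{dom} f$. Suppose either of the following holds: (i) the action is free or typical at $\overline{x}$; (ii) $f$ is Lipschitz continuous near $\overline{x}\in\mathrm{int}\,\mathrm{dom} f$, or $f$ is regular at $\overline{x}$. Then, for all $x\in\mathrm{dom}\,\partial f$ near $\overline{x}$, $$\forall v\in\overline{\partial}f(x),\ \forall\alpha\in\mathbb{R},\quad C(x+\alpha v)=C(x)+\alpha^2C(v)\quad\text{and}\quad dC(x)(v)=0.$$ In particular, $C$ is conserved near $\overline{x}$ along the differential inclusion $$x'(t)\in-\overline{\partial}f(x(t))\quad\text{for almost every }t>0,$$ i.e. there is a neighborhood $U$ of $\overline{x}$ such that for every absolutely continuous solution $x(\cdot)$, $C\circ x$ is constant on every time interval during which $x(t)\in U$.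
   Context: $\mathrm{dom} f=\{x:f(x)<\infty\}$, $\mathrm{dom}\,\partial f=\{x:\partial f(x)\neq\emptyset\}$, $\mathrm{int}$ is the interior; neighborhoods are open. The natural action is $(g,x)\mapsto gx$ (matrix-vector product). $\mathfrak{g}=T_{I_n}G\subseteq\mathbb{R}^{n\times n}$ is the Lie algebra, $\mathrm{s}(\mathfrak{g})$ the subspace of its symmetric elements, and $P_{\mathrm{s}(\mathfrak{g})}$ the orthogonal projection of $\mathbb{R}^{n\times n}$ onto it for the Frobenius inner product. $G_x=\{g\in G:gx=x\}$; the action is free at $x$ if $G_x=\{I_n\}$. The orbit type $\tau(x)$ is the conjugacy class of $G_x$ in $G$. The action is proper near $x$ if there is a neighborhood $U$ of $x$ such that $\{g\in G:U\cap gU\ne\emptyset\}$ has compact closure (in $G$). It is typical at $x$ if it is proper near $x$ and $\tau$ is constant near $x$. $f$ is Lipschitz continuous near $\overline{x}$ if there is $L>0$ with $|f(x)-f(y)|\le L|x-y|$ for $x,y\in\mathrm{dom} f$ near $\overline{x}$. For $S\subseteq\mathbb{R}^m$ and $\bar s\in S$: $\widehat N_S(\bar s)=\{v:\langle v,s-\bar s\rangle\le o(|s-\bar s|)\text{ for }s\in S\text{ near }\bar s\}$ and $N_S(\bar s)$ is the set of limits of $v_k\in\widehat N_S(s_k)$ with $S\ni s_k\to\bar s$; $S$ is regular at $\bar s$ if it is locally closed there and $\widehat N_S(\bar s)=N_S(\bar s)$. $f$ is regular at $\overline{x}$ if $f(\overline{x})$ is finite and $\mathrm{epi} f=\{(x,t):f(x)\le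 t\}$ is regular at $(\overline{x},f(\overline{x}))$. Subdifferentials, at a point $\overline{x}$ where $f$ is finite (empty otherwise): $\widehat\partial f(\overline{x})=\{v: f(x)\ge f(\overline{x})+\langle v,x-\overline{x}\rangle+o(|x-\overline{x}|)\text{ near }\overline{x}\}$; $\partial f(\overline{x})$ is the set of $v$ for which there are $x_k$ and $v_k\in\widehat\partial f(x_k)$ with $(x_k,f(x_k),v_k)\to(\overline{x},f(\overline{x}),v)$; $\partial^\infty f(\overline{x})$ is the set of $v$ for which there are $x_k$, $v_k\in\widehat\partial f(x_k)$ and $\tau_k\searrow0$ with $(x_k,f(x_k),\tau_kv_k)\to(\overline{x},f(\overline{x}),v)$; the Clarke subdifferential is $\overline{\partial}f(\overline{x})=\overline{\mathrm{co}}[\partial f(\overline{x})+\partial^\infty f(\overline{x})]$ (closed convex hull). *)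

theory Defs
  imports "HOL-Analysis.Analysis"
begin

section \<open>Smooth maps\<close>

text \<open>\<^term>\<open>U\<close> is meant to be open.\<close>

primrec Ck_on :: "nat \<Rightarrow> 'a::euclidean_space set \<Rightarrow> ('a \<Rightarrow> 'b::euclidean_space) \<Rightarrow> bool" where
  "Ck_on 0 U f \<longleftrightarrow> continuous_on U f"
| "Ck_on (Suc k) U f \<longleftrightarrow> (\<forall>x\<in>U. f differentiable (at x)) \<and>
     (\<forall>v. Ck_on k U (\<lambda>x. frechet_derivative f (at x) v))"

text \<open>Smoothness on an arbitrary set means existence of smooth local extensions. For a relatively
  open subset of a linear subspace \<open>E\<close> this is ordinary smoothness in linear coordinates of \<open>E\<close>.\<close>

definition smooth_on :: "'a::euclidean_space set \<Rightarrow> ('a \<Rightarrow> 'b::euclidean_space) \<Rightarrow> bool" where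
  "smooth_on A f \<longleftrightarrow> (\<forall>a\<in>A. \<exists>U g. open U \<and> a \<in> U \<and> (\<forall>k. Ck_on k U g) \<and>
     (\<forall>x\<in>U \<inter> A. g x = f x))"


section \<open>Lie subgroups of the general linear group\<close>

text \<open>
  An immersed submanifold is represented by its own topology \<open>M\<close>, which may be finer than the
  subspace topology; its set of points is \<open>topspace M\<close>. A local parametrization is an immersion
  \<open>\<phi>\<close>, defined on an open subset \<open>W\<close> of a linear model space \<open>E\<close>, that is a homeomorphism onto an
  \<open>M\<close>-open set. Model spaces are linear subspaces rather than types of the form \<open>real ^ 'd\<close> so that
  the dimension is unconstrained; in particular it may be 0 (discrete groups).

  Given \<open>M\<close>, any two local parametrizations are smoothly compatible, so \<open>M\<close> determines the smooth
  structure and no atlas needs to be recorded.\<close>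

definition local_param ::
  "'a::euclidean_space topology \<Rightarrow> 'a set \<Rightarrow> 'a set \<Rightarrow> ('a \<Rightarrow> 'a) \<Rightarrow> bool" where
  "local_param M E W \<phi> \<longleftrightarrow>
     openin (top_of_set E) W \<and> openin M (\<phi> ` W) \<and>
     homeomorphic_map (top_of_set W) (subtopology M (\<phi> ` W)) \<phi> \<and>
     smooth_on W \<phi> \<and>
     (\<forall>w\<in>W. \<exists>D. (\<phi> has_derivative D) (at w within W) \<and> inj_on D E)"

definition immersed_submanifold :: "'a::euclidean_space topology \<Rightarrow> 'a set \<Rightarrow> bool" where
  "immersed_submanifold M E \<longleftrightarrow>
     subspace E \<and> Hausdorff_space M \<and> second_countable M \<and>
     (\<forall>p\<in>topspace M. \<exists>W \<phi>. local_param M E W \<phi> \<and> p \<in> \<phi> ` W)"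

text \<open>A subgroup of the general linear group that is an immersed submanifold and whose
  multiplication and inversion are smooth when read in local coordinates.\<close>

definition lie_subgroup :: "(real ^ 'n ^ 'n) topology \<Rightarrow> bool" where
  "lie_subgroup G \<longleftrightarrow>
     (\<forall>g\<in>topspace G. invertible g) \<and>
     mat 1 \<in> topspace G \<and>
     (\<forall>g\<in>topspace G. \<forall>h\<in>topspace G. g ** h \<in> topspace G) \<and>
     (\<forall>g\<in>topspace G. matrix_inv g \<in> topspace G) \<and>
     (\<exists>E. immersed_submanifold G E \<and>
       (\<forall>g\<in>topspace G. \<forall>h\<in>topspace G. \<exists>W1 \<phi>1 W2 \<phi>2 W3 \<phi>3.
          local_param G E W1 \<phi>1 \<and> local_param G E W2 \<phi>2 \<and> local_param G E W3 \<phi>3 \<and>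
          g \<in> \<phi>1 ` W1 \<and> h \<in> \<phi>2 ` W2 \<and>
          (\<forall>a\<in>W1. \<forall>b\<in>W2. \<phi>1 a ** \<phi>2 b \<in> \<phi>3 ` W3) \<and>
          smooth_on (W1 \<times> W2) (\<lambda>(a, b). inv_into W3 \<phi>3 (\<phi>1 a ** \<phi>2 b))) \<and>
       (\<forall>g\<in>topspace G. \<exists>W1 \<phi>1 W2 \<phi>2.
          local_param G E W1 \<phi>1 \<and> local_param G E W2 \<phi>2 \<and>
          g \<in> \<phi>1 ` W1 \<and>
          (\<forall>a\<in>W1. matrix_inv (\<phi>1 a) \<in> \<phi>2 ` W2) \<and>
          smooth_on W1 (\<lambda>a. inv_into W2 \<phi>2 (matrix_inv (\<phi>1 a)))))"

text \<open>Velocities at \<open>p\<close> of smooth curves in \<open>M\<close>. A map into an immersed submanifold is smooth iff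
  it is smooth into the ambient space and continuous for the topology of the submanifold.\<close>

definition tangent_space :: "'a::euclidean_space topology \<Rightarrow> 'a \<Rightarrow> 'a set" where
  "tangent_space M p = {v. \<exists>e>0. \<exists>\<gamma>::real \<Rightarrow> 'a.
     continuous_map (top_of_set {-e<..<e}) M \<gamma> \<and> smooth_on {-e<..<e} \<gamma> \<and>
     \<gamma> 0 = p \<and> (\<gamma> has_vector_derivative v) (at 0)}"

definition lie_algebra :: "(real ^ 'n ^ 'n) topology \<Rightarrow> (real ^ 'n ^ 'n) set" where
  "lie_algebra G = tangent_space G (mat 1)"

definition sym_part :: "(real ^ 'n ^ 'n) set \<Rightarrow> (real ^ 'n ^ 'n) set" where
  "sym_part \<gg> = {A \<in> \<gg>. transpose A = A}"

text \<open>The inner product of \<^typ>\<open>real ^ 'n ^ 'n\<close> is the Frobenius inner product.\<close>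

definition orth_proj :: "'a::euclidean_space set \<Rightarrow> 'a \<Rightarrow> 'a" where
  "orth_proj S x = (THE y. y \<in> S \<and> (\<forall>z\<in>S. (x - y) \<bullet> z = 0))"

definition C_map :: "(real ^ 'n ^ 'n) topology \<Rightarrow> real ^ 'n \<Rightarrow> real ^ 'n ^ 'n" where
  "C_map G x = orth_proj (sym_part (lie_algebra G)) (\<chi> i j. x $ i * x $ j)"


section \<open>The natural action\<close>

definition stabilizer :: "(real ^ 'n ^ 'n) topology \<Rightarrow> real ^ 'n \<Rightarrow> (real ^ 'n ^ 'n) set" where
  "stabilizer G x = {g \<in> topspace G. g *v x = x}"

definition free_at :: "(real ^ 'n ^ 'n) topology \<Rightarrow> real ^ 'n \<Rightarrow> bool" where
  "free_at G x \<longleftrightarrow> stabilizer G x = {mat 1}"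

definition orbit_type :: "(real ^ 'n ^ 'n) topology \<Rightarrow> real ^ 'n \<Rightarrow> (real ^ 'n ^ 'n) set set" where
  "orbit_type G x = (\<lambda>g. (\<lambda>h. g ** h ** matrix_inv g) ` stabilizer G x) ` topspace G"

text \<open>Closure and compactness refer to the topology of the group.\<close>

definition proper_near :: "(real ^ 'n ^ 'n) topology \<Rightarrow> real ^ 'n \<Rightarrow> bool" where
  "proper_near G x \<longleftrightarrow> (\<exists>U. open U \<and> x \<in> U \<and>
     compactin G (G closure_of {g \<in> topspace G. U \<inter> (\<lambda>y. g *v y) ` U \<noteq> {}}))"

definition typical_at :: "(real ^ 'n ^ 'n) topology \<Rightarrow> real ^ 'n \<Rightarrow> bool" where
  "typical_at G x \<longleftrightarrow> proper_near G x \<and> (\<forall>\<^sub>F y in nhds x. orbit_type G y = orbit_type G x)"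


section \<open>Variational analysis\<close>

text \<open>Functions with values in the reals extended by \<open>\<infinity>\<close> are \<^typ>\<open>ereal\<close>-valued functions that
  never take the value \<open>-\<infinity>\<close>; this is assumed where it is needed.\<close>

definition edom :: "('a \<Rightarrow> ereal) \<Rightarrow> 'a set" where
  "edom f = {x. f x < \<infinity>}"

definition epi :: "('a \<Rightarrow> ereal) \<Rightarrow> ('a \<times> real) set" where
  "epi f = {(x, t). f x \<le> ereal t}"

definition lipschitz_near :: "('a::real_normed_vector \<Rightarrow> ereal) \<Rightarrow> 'a \<Rightarrow> bool" where
  "lipschitz_near f x0 \<longleftrightarrow> (\<exists>L>0. \<exists>U. open U \<and> x0 \<in> U \<and>
     (\<forall>x\<in>U \<inter> edom f. \<forall>y\<in>U \<inter> edom f. \<bar>f x - f y\<bar> \<le> ereal (L * norm (x - y))))"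

definition regular_normals :: "'a::euclidean_space set \<Rightarrow> 'a \<Rightarrow> 'a set" where
  "regular_normals S s0 = {v. \<exists>r. r \<in> o[at s0 within S](\<lambda>s. norm (s - s0)) \<and>
     (\<forall>\<^sub>F s in at s0 within S. v \<bullet> (s - s0) \<le> r s)}"

definition normals :: "'a::euclidean_space set \<Rightarrow> 'a \<Rightarrow> 'a set" where
  "normals S s0 = {v. \<exists>s w. (\<forall>k. s k \<in> S \<and> w k \<in> regular_normals S (s k)) \<and>
     s \<longlonglongrightarrow> s0 \<and> w \<longlonglongrightarrow> v}"

definition locally_closed_at :: "'a::topological_space set \<Rightarrow> 'a \<Rightarrow> bool" where
  "locally_closed_at S s0 \<longleftrightarrow> (\<exists>V. closed V \<and> s0 \<in> interior V \<and> closed (S \<inter> V))"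

definition regular_set_at :: "'a::euclidean_space set \<Rightarrow> 'a \<Rightarrow> bool" where
  "regular_set_at S s0 \<longleftrightarrow> locally_closed_at S s0 \<and> regular_normals S s0 = normals S s0"

definition regular_fun_at :: "('a::euclidean_space \<Rightarrow> ereal) \<Rightarrow> 'a \<Rightarrow> bool" where
  "regular_fun_at f x \<longleftrightarrow> \<bar>f x\<bar> \<noteq> \<infinity> \<and> regular_set_at (epi f) (x, real_of_ereal (f x))"

definition regular_subdiff :: "('a::euclidean_space \<Rightarrow> ereal) \<Rightarrow> 'a \<Rightarrow> 'a set" where
  "regular_subdiff f x0 = {v. \<bar>f x0\<bar> \<noteq> \<infinity> \<and>
     (\<exists>r. r \<in> o[at x0](\<lambda>x. norm (x - x0)) \<and>
        (\<forall>\<^sub>F x in at x0. f x \<ge> f x0 + ereal (v \<bullet> (x - x0) + r x)))}"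

definition subdiff :: "('a::euclidean_space \<Rightarrow> ereal) \<Rightarrow> 'a \<Rightarrow> 'a set" where
  "subdiff f x0 = {v. \<bar>f x0\<bar> \<noteq> \<infinity> \<and>
     (\<exists>x w. (\<forall>k. w k \<in> regular_subdiff f (x k)) \<and>
        x \<longlonglongrightarrow> x0 \<and> (\<lambda>k. f (x k)) \<longlonglongrightarrow> f x0 \<and> w \<longlonglongrightarrow> v)}"

definition horizon_subdiff :: "('a::euclidean_space \<Rightarrow> ereal) \<Rightarrow> 'a \<Rightarrow> 'a set" where
  "horizon_subdiff f x0 = {v. \<bar>f x0\<bar> \<noteq> \<infinity> \<and>
     (\<exists>x w \<tau>. (\<forall>k. w k \<in> regular_subdiff f (x k)) \<and> (\<forall>k. (\<tau> k :: real) > 0) \<and> \<tau> \<longlonglongrightarrow> 0 \<and>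
        x \<longlonglongrightarrow> x0 \<and> (\<lambda>k. f (x k)) \<longlonglongrightarrow> f x0 \<and> (\<lambda>k. \<tau> k *\<^sub>R w k) \<longlonglongrightarrow> v)}"

definition clarke_subdiff :: "('a::euclidean_space \<Rightarrow> ereal) \<Rightarrow> 'a \<Rightarrow> 'a set" where
  "clarke_subdiff f x = closure (convex hull {u + w | u w. u \<in> subdiff f x \<and> w \<in> horizon_subdiff f x})"

definition dom_subdiff :: "('a::euclidean_space \<Rightarrow> ereal) \<Rightarrow> 'a set" where
  "dom_subdiff f = {x. subdiff f x \<noteq> {}}"


section \<open>Subgradient trajectories\<close>

definition abs_continuous_on :: "real \<Rightarrow> real \<Rightarrow> (real \<Rightarrow> 'a::real_normed_vector) \<Rightarrow> bool" where
  "abs_continuous_on a b x \<longleftrightarrow> (\<forall>\<epsilon>>0. \<exists>\<delta>>0. \<forall>P :: (real \<times> real) set.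
     finite P \<and> (\<forall>(s, t)\<in>P. a \<le> s \<and> s \<le> t \<and> t \<le> b) \<and>
     pairwise (\<lambda>(s, t) (s', t'). disjnt {s<..<t} {s'<..<t'}) P \<and>
     (\<Sum>(s, t)\<in>P. t - s) < \<delta> \<longrightarrow> (\<Sum>(s, t)\<in>P. norm (x t - x s)) < \<epsilon>)"

text \<open>Curves on \<open>[0, \<infinity>)\<close>, absolutely continuous on every compact subinterval; the values at
  negative times are irrelevant.\<close>

definition clarke_trajectory ::
  "('a::euclidean_space \<Rightarrow> ereal) \<Rightarrow> (real \<Rightarrow> 'a) \<Rightarrow> bool" where
  "clarke_trajectory f x \<longleftrightarrow>
     (\<forall>T\<ge>0. abs_continuous_on 0 T x) \<and>
     (AE t in lebesgue. t > 0 \<longrightarrow>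
        (\<exists>x'. (x has_vector_derivative x') (at t) \<and> x' \<in> uminus ` clarke_subdiff f (x t)))"

end

theory Submission
  imports Defs
begin

text \<open>
  The map \<open>C\<close> is the quadratic map \<open>x \<mapsto> P (x x\<^sup>T)\<close>, where \<open>P\<close> is the orthogonal projection onto
  the symmetric part of the Lie algebra. Expanding the square, both pointwise claims say that the
  cross term \<open>P (x v\<^sup>T + v x\<^sup>T)\<close> vanishes, i.e. that for every symmetric \<open>A\<close> in the Lie algebra
  \<open>0 = A \<bullet> (x v\<^sup>T + v x\<^sup>T) = 2 v \<bullet> (A x)\<close>. So the algebraic statement reduces to a geometric
  one: Clarke subgradients at \<open>x\<close> are orthogonal to the tangent directions \<open>A x\<close> of the orbit of
  \<open>x\<close>.

  That orthogonality comes from invariance (\<open>clarke_subdiff_orthogonal_orbit\<close>). If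
  \<open>\<gamma>\<close> is a curve in the group through the identity with velocity \<open>A\<close>, then \<open>f\<close> is constant along
  \<open>t \<mapsto> \<gamma> t x\<close>, and the inequality that defines a regular subgradient \<open>v\<close> forces
  \<open>v \<bullet> (A x) \<le> 0\<close>; replacing \<open>A\<close> by \<open>-A\<close> gives equality. The condition \<open>v \<bullet> (A x) = 0\<close> is
  closed in \<open>(x, v)\<close> and linear in \<open>v\<close>, hence survives the limits, the rescaling and the closed
  convex hull that lead to the Clarke subdifferential. The argument works at every point, so the
  whole space can serve as the neighborhood in both claims.

  Two supporting facts take the most room. The projection \<open>P\<close> exists and is linear because the
  Lie algebra is a linear subspace (\<open>subspace_lie_algebra\<close>): sums of velocities are velocities of
  products of curves, which requires multiplication to be continuous for the topology of the
  group. And along a trajectory \<open>x\<close> the function \<open>C \<circ> x\<close> is absolutely continuous with derivative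
  zero almost everywhere; such a function is constant
  (\<open>abs_continuous_on_derivative_zero_AE_imp_eq\<close>).
\<close>

section \<open>Calculus of smooth maps\<close>

lemma Ck_on_cong:
  assumes "open U" and "\<And>x. x \<in> U \<Longrightarrow> f x = g x"
  shows "Ck_on k U f \<longleftrightarrow> Ck_on k U g"
  using assms(2)
proof (induction k arbitrary: f g)
  case 0
  then show ?case
    by (simp cong: continuous_on_cong)
next
  case (Suc k)
  have der: "(f has_derivative D) (at x) \<longleftrightarrow> (g has_derivative D) (at x)" if "x \<in> U" for x D
    using has_derivative_transform_within_open[OF _ \<open>open U\<close> that, of f D UNIV g]
      has_derivative_transform_within_open[OF _ \<open>open U\<close> that, of g D UNIV f] Suc.prems by auto
  have "frechet_derivative f (at x) = frechet_derivative g (at x)" if "x \<in> U" for x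
    by (simp add: frechet_derivative_def der[OF that])
  then have "\<And>x. x \<in> U \<Longrightarrow> frechet_derivative f (at x) v = frechet_derivative g (at x) v" for v
    by simp
  then have "Ck_on k U (\<lambda>x. frechet_derivative f (at x) v) \<longleftrightarrow>
             Ck_on k U (\<lambda>x. frechet_derivative g (at x) v)" for v
    by (rule Suc.IH)
  moreover have "f differentiable (at x) \<longleftrightarrow> g differentiable (at x)" if "x \<in> U" for x
    by (simp add: differentiable_def der[OF that])
  ultimately show ?case
    by simp
qed

lemma Ck_on_subset: "Ck_on k U f \<Longrightarrow> V \<subseteq> U \<Longrightarrow> Ck_on k V f"
proof (induction k arbitrary: f)
  case 0
  then show ?case
    using continuous_on_subset by auto
next
  case (Suc k)
  then show ?case
    by (auto intro: Suc.IH)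
qed

lemma Ck_on_Suc_imp: "Ck_on (Suc k) U f \<Longrightarrow> Ck_on k U f"
proof (induction k arbitrary: f)
  case 0
  then show ?case
    by (simp add: continuous_at_imp_continuous_on differentiable_imp_continuous_within)
next
  case (Suc k)
  show ?case
    using Suc.prems Suc.IH by (metis Ck_on.simps(2))
qed

lemma Ck_on_const: "Ck_on k U (\<lambda>x. c)"
  by (induction k arbitrary: c) (auto simp: frechet_derivative_const)

lemma Ck_on_add:
  assumes "open U"
  shows "Ck_on k U f \<Longrightarrow> Ck_on k U g \<Longrightarrow> Ck_on k U (\<lambda>x. f x + g x)"
proof (induction k arbitrary: f g)
  case 0
  then show ?case
    by (auto intro: continuous_intros)
next
  case (Suc k)
  have der: "((\<lambda>x. f x + g x) has_derivative
      (\<lambda>v. frechet_derivative f (at x) v + frechet_derivative g (at x) v)) (at x)"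
    if "x \<in> U" for x
    using Suc.prems that
    by (intro has_derivative_add) (auto simp: frechet_derivative_works[symmetric])
  have "Ck_on k U (\<lambda>x. frechet_derivative (\<lambda>x. f x + g x) (at x) v)" for v
  proof -
    have "Ck_on k U (\<lambda>x. frechet_derivative f (at x) v + frechet_derivative g (at x) v)"
      using Suc by auto
    moreover have "frechet_derivative (\<lambda>x. f x + g x) (at x) v =
        frechet_derivative f (at x) v + frechet_derivative g (at x) v" if "x \<in> U" for x
      using frechet_derivative_at[OF der[OF that]] by metis
    ultimately show ?thesis
      by (rule iffD2[OF Ck_on_cong[OF assms], rotated])
  qed
  then show ?case
    using der by (auto simp: differentiable_def)
qed

text \<open>By the product rule the derivative is a sum of bilinear expressions in maps that are one
  order less smooth, to which the induction hypothesis applies.\<close>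

lemma Ck_on_bounded_bilinear:
  assumes "open U" and B: "bounded_bilinear B"
  shows "Ck_on k U f \<Longrightarrow> Ck_on k U g \<Longrightarrow> Ck_on k U (\<lambda>x. B (f x) (g x))"
proof (induction k arbitrary: f g)
  case 0
  then show ?case
    using bounded_bilinear.continuous_on[OF B] by auto
next
  case (Suc k)
  have der: "((\<lambda>x. B (f x) (g x)) has_derivative
      (\<lambda>v. B (f x) (frechet_derivative g (at x) v) + B (frechet_derivative f (at x) v) (g x))) (at x)"
    if "x \<in> U" for x
    using Suc.prems that
    by (intro bounded_bilinear.FDERIV[OF B]) (auto simp: frechet_derivative_works[symmetric])
  have "Ck_on k U (\<lambda>x. frechet_derivative (\<lambda>x. B (f x) (g x)) (at x) v)" for v
  proof -
    have "Ck_on k U (\<lambda>x. B (f x) (frechet_derivative g (at x) v) +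
                         B (frechet_derivative f (at x) v) (g x))"
      using Suc.prems Ck_on_Suc_imp[OF Suc.prems(1)] Ck_on_Suc_imp[OF Suc.prems(2)]
      by (intro Ck_on_add[OF \<open>open U\<close>] Suc.IH) simp_all
    moreover have "frechet_derivative (\<lambda>x. B (f x) (g x)) (at x) v =
        B (f x) (frechet_derivative g (at x) v) + B (frechet_derivative f (at x) v) (g x)"
      if "x \<in> U" for x
      using frechet_derivative_at[OF der[OF that]] by metis
    ultimately show ?thesis
      by (rule iffD2[OF Ck_on_cong[OF \<open>open U\<close>], rotated])
  qed
  then show ?case
    using der by (auto simp: differentiable_def)
qed

lemma Ck_on_compose_linear:
  assumes "open U" and L: "bounded_linear L"
  shows "Ck_on k U f \<Longrightarrow> Ck_on k (L -` U) (\<lambda>x. f (L x))"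
proof (induction k arbitrary: f)
  case 0
  have "continuous_on (L -` U) L"
    using L by (simp add: linear_continuous_on)
  then show ?case
    using 0 by (auto intro: continuous_on_compose2)
next
  case (Suc k)
  have der: "((\<lambda>x. f (L x)) has_derivative (\<lambda>v. frechet_derivative f (at (L x)) (L v))) (at x)"
    if "x \<in> L -` U" for x
  proof -
    have "(f has_derivative frechet_derivative f (at (L x))) (at (L x))"
      using Suc.prems that by (simp add: frechet_derivative_works[symmetric])
    from has_derivative_compose[OF bounded_linear_imp_has_derivative[OF L] this]
    show ?thesis .
  qed
  have op: "open (L -` U)"
    using L \<open>open U\<close> by (simp add: continuous_open_vimage linear_continuous_at)
  have "Ck_on k (L -` U) (\<lambda>x. frechet_derivative (\<lambda>x. f (L x)) (at x) v)" for v
  proof -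
    have "Ck_on k (L -` U) (\<lambda>x. frechet_derivative f (at (L x)) (L v))"
      using Suc by auto
    moreover have "frechet_derivative (\<lambda>x. f (L x)) (at x) v = frechet_derivative f (at (L x)) (L v)"
      if "x \<in> L -` U" for x
      using frechet_derivative_at[OF der[OF that]] by metis
    ultimately show ?thesis
      by (rule iffD2[OF Ck_on_cong[OF op], rotated])
  qed
  then show ?case
    using der by (auto simp: differentiable_def)
qed

lemma smooth_onE:
  assumes "smooth_on A f" "a \<in> A"
  obtains U g where "open U" "a \<in> U" "\<And>k. Ck_on k U g" "\<And>x. x \<in> U \<Longrightarrow> x \<in> A \<Longrightarrow> g x = f x"
proof -
  obtain U g where "open U" "a \<in> U" "\<forall>k. Ck_on k U g" "\<forall>x\<in>U \<inter> A. g x = f x"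
    using bspec[OF assms(1)[unfolded smooth_on_def] assms(2)] by (elim exE conjE)
  then show thesis
    by (intro that[of U g]) auto
qed

lemma smooth_onI:
  assumes "\<And>a. a \<in> A \<Longrightarrow> \<exists>U g. open U \<and> a \<in> U \<and> (\<forall>k. Ck_on k U g) \<and> (\<forall>x\<in>U \<inter> A. g x = f x)"
  shows "smooth_on A f"
  using assms by (simp add: smooth_on_def)

lemma smooth_on_subset:
  assumes "smooth_on A f" "B \<subseteq> A"
  shows "smooth_on B f"
proof (rule smooth_onI)
  fix a assume "a \<in> B"
  then have "a \<in> A"
    using assms(2) by blast
  then obtain U g where "open U" "a \<in> U" "\<And>k. Ck_on k U g" "\<And>x. x \<in> U \<Longrightarrow> x \<in> A \<Longrightarrow> g x = f x"
    using smooth_onE[OF assms(1)] by metis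
  then show "\<exists>U g. open U \<and> a \<in> U \<and> (\<forall>k. Ck_on k U g) \<and> (\<forall>x\<in>U \<inter> B. g x = f x)"
    using \<open>B \<subseteq> A\<close> by (intro exI[of _ U] exI[of _ g]) auto
qed

lemma smooth_on_const: "smooth_on A (\<lambda>x. c)"
  by (intro smooth_onI exI[of _ UNIV] exI[of _ "\<lambda>x. c"]) (simp add: Ck_on_const)

lemma smooth_on_bounded_bilinear:
  assumes "smooth_on A f" "smooth_on A g" and B: "bounded_bilinear B"
  shows "smooth_on A (\<lambda>x. B (f x) (g x))"
proof (rule smooth_onI)
  fix a assume "a \<in> A"
  obtain U f' where U: "open U" "a \<in> U" "\<And>k. Ck_on k U f'" "\<And>x. x \<in> U \<Longrightarrow> x \<in> A \<Longrightarrow> f' x = f x"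
    using smooth_onE[OF assms(1) \<open>a \<in> A\<close>] by metis
  obtain V g' where V: "open V" "a \<in> V" "\<And>k. Ck_on k V g'" "\<And>x. x \<in> V \<Longrightarrow> x \<in> A \<Longrightarrow> g' x = g x"
    using smooth_onE[OF assms(2) \<open>a \<in> A\<close>] by metis
  have "Ck_on k (U \<inter> V) (\<lambda>x. B (f' x) (g' x))" for k
    using U V Ck_on_subset[of k U f' "U \<inter> V"] Ck_on_subset[of k V g' "U \<inter> V"]
    by (intro Ck_on_bounded_bilinear[OF _ B]) auto
  then show "\<exists>U h. open U \<and> a \<in> U \<and> (\<forall>k. Ck_on k U h) \<and> (\<forall>x\<in>U \<inter> A. h x = B (f x) (g x))"
    using U V by (intro exI[of _ "U \<inter> V"] exI[of _ "\<lambda>x. B (f' x) (g' x)"]) auto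
qed

lemma smooth_on_compose_linear:
  assumes "smooth_on A f" and L: "bounded_linear L"
  shows "smooth_on (L -` A) (\<lambda>x. f (L x))"
proof (rule smooth_onI)
  fix a assume "a \<in> L -` A"
  then obtain U g where U: "open U" "L a \<in> U" "\<And>k. Ck_on k U g" "\<And>x. x \<in> U \<Longrightarrow> x \<in> A \<Longrightarrow> g x = f x"
    using smooth_onE[OF assms(1), of "L a"] by (metis vimageD)
  have "open (L -` U)"
    using L \<open>open U\<close> by (simp add: continuous_open_vimage linear_continuous_at)
  then show "\<exists>U h. open U \<and> a \<in> U \<and> (\<forall>k. Ck_on k U h) \<and> (\<forall>x\<in>U \<inter> L -` A. h x = f (L x))"
    using U Ck_on_compose_linear[OF \<open>open U\<close> L]
    by (intro exI[of _ "L -` U"] exI[of _ "\<lambda>x. g (L x)"]) auto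
qed

lemma smooth_on_imp_continuous_on:
  assumes "smooth_on A f"
  shows "continuous_on A f"
  unfolding continuous_on_eq_continuous_within
proof
  fix a assume "a \<in> A"
  then obtain U g where U: "open U" "a \<in> U" "\<And>k. Ck_on k U g" "\<And>x. x \<in> U \<Longrightarrow> x \<in> A \<Longrightarrow> g x = f x"
    using smooth_onE[OF assms] by metis
  have "continuous_on U g"
    using U(3)[of 0] by simp
  then have "isCont g a"
    using U by (simp add: continuous_on_eq_continuous_at)
  then have "(g \<longlongrightarrow> g a) (at a within A)"
    using continuous_at_imp_continuous_at_within continuous_within by blast
  moreover have "\<forall>\<^sub>F x in at a within A. g x = f x"
    using U unfolding eventually_at_topological by (intro exI[of _ U]) auto
  ultimately have "(f \<longlongrightarrow> g a) (at a within A)"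
    by (rule Lim_transform_eventually)
  moreover have "g a = f a"
    using U \<open>a \<in> A\<close> by blast
  ultimately show "continuous (at a within A) f"
    by (simp add: continuous_within)
qed


section \<open>The Lie algebra is a linear subspace\<close>

lemma bounded_bilinear_matrix_matrix_mult:
  "bounded_bilinear ((**) :: real ^ 'n ^ 'm \<Rightarrow> real ^ 'p ^ 'n \<Rightarrow> real ^ 'p ^ 'm)"
proof -
  have "(A + B) ** C = A ** C + B ** C" for A B :: "real ^ 'n ^ 'm" and C :: "real ^ 'p ^ 'n"
    by (vector matrix_matrix_mult_def sum.distrib[symmetric] field_simps)
  then show ?thesis
    by (simp add: bilinear_conv_bounded_bilinear[symmetric] bilinear_def linear_iff
        matrix_add_ldistrib scalar_matrix_assoc matrix_scalar_ac)
qed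

text \<open>Near a pair of group elements multiplication is \<open>\<phi>3 \<circ> m \<circ> (\<phi>1\<inverse>, \<phi>2\<inverse>)\<close> for charts
  \<open>\<phi>1\<close>, \<open>\<phi>2\<close>, \<open>\<phi>3\<close> and a smooth \<open>m\<close>. The topology of the group may be finer than that of the
  ambient matrix space, so continuity has to be read off from the charts.\<close>

lemma lie_subgroup_mult_continuous:
  assumes "lie_subgroup G"
  shows "continuous_map (prod_topology G G) G (\<lambda>(g, h). g ** h)"
proof -
  obtain E where E: "\<forall>g\<in>topspace G. \<forall>h\<in>topspace G. \<exists>W1 \<phi>1 W2 \<phi>2 W3 \<phi>3.
          local_param G E W1 \<phi>1 \<and> local_param G E W2 \<phi>2 \<and> local_param G E W3 \<phi>3 \<and>
          g \<in> \<phi>1 ` W1 \<and> h \<in> \<phi>2 ` W2 \<and>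
          (\<forall>a\<in>W1. \<forall>b\<in>W2. \<phi>1 a ** \<phi>2 b \<in> \<phi>3 ` W3) \<and>
          smooth_on (W1 \<times> W2) (\<lambda>(a, b). inv_into W3 \<phi>3 (\<phi>1 a ** \<phi>2 b))"
    using assms unfolding lie_subgroup_def by metis
  have local: "\<exists>T. openin (prod_topology G G) T \<and> p \<in> T \<and>
      continuous_map (subtopology (prod_topology G G) T) G (\<lambda>(g, h). g ** h)"
    if p: "p \<in> topspace (prod_topology G G)" for p
  proof -
    obtain g h where gh: "p = (g, h)" "g \<in> topspace G" "h \<in> topspace G"
      using p by auto
    obtain W1 \<phi>1 W2 \<phi>2 W3 \<phi>3 where lp:
        "local_param G E W1 \<phi>1" "local_param G E W2 \<phi>2" "local_param G E W3 \<phi>3"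
      and mem: "g \<in> \<phi>1 ` W1" "h \<in> \<phi>2 ` W2"
      and prod: "\<forall>a\<in>W1. \<forall>b\<in>W2. \<phi>1 a ** \<phi>2 b \<in> \<phi>3 ` W3"
      and sm: "smooth_on (W1 \<times> W2) (\<lambda>(a, b). inv_into W3 \<phi>3 (\<phi>1 a ** \<phi>2 b))"
      using E gh by meson
    let ?T = "\<phi>1 ` W1 \<times> \<phi>2 ` W2"
    let ?m = "\<lambda>(a, b). inv_into W3 \<phi>3 (\<phi>1 a ** \<phi>2 b)"
    have chart: "\<exists>\<psi>. continuous_map (subtopology G (\<phi> ` W)) (top_of_set W) \<psi> \<and>
        (\<forall>w\<in>W. \<psi> (\<phi> w) = w)" if "local_param G E W \<phi>" for W \<phi>
    proof -
      have "homeomorphic_map (top_of_set W) (subtopology G (\<phi> ` W)) \<phi>"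
        using that by (simp add: local_param_def)
      then obtain \<psi> where "homeomorphic_maps (top_of_set W) (subtopology G (\<phi> ` W)) \<phi> \<psi>"
        by (auto simp: homeomorphic_map_maps)
      then show ?thesis
        by (auto simp: homeomorphic_maps_def)
    qed
    obtain \<psi>1 where \<psi>1: "continuous_map (subtopology G (\<phi>1 ` W1)) (top_of_set W1) \<psi>1"
        "\<forall>w\<in>W1. \<psi>1 (\<phi>1 w) = w"
      using chart[OF lp(1)] by blast
    obtain \<psi>2 where \<psi>2: "continuous_map (subtopology G (\<phi>2 ` W2)) (top_of_set W2) \<psi>2"
        "\<forall>w\<in>W2. \<psi>2 (\<phi>2 w) = w"
      using chart[OF lp(2)] by blast
    have c1: "continuous_map (subtopology (prod_topology G G) ?T) (top_of_set (W1 \<times> W2))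
        (\<lambda>p. (\<psi>1 (fst p), \<psi>2 (snd p)))"
      unfolding subtopology_Times prod_topology_subtopology_eu[symmetric]
      by (intro continuous_map_pairedI continuous_map_compose[OF continuous_map_fst \<psi>1(1), unfolded o_def]
          continuous_map_compose[OF continuous_map_snd \<psi>2(1), unfolded o_def])
    have c2: "continuous_map (top_of_set (W1 \<times> W2)) (top_of_set W3) ?m"
      using smooth_on_imp_continuous_on[OF sm] prod
      by (auto simp: continuous_map_in_subtopology intro!: inv_into_into)
    have "homeomorphic_map (top_of_set W3) (subtopology G (\<phi>3 ` W3)) \<phi>3"
      using lp(3) by (simp add: local_param_def)
    then have c3: "continuous_map (top_of_set W3) G \<phi>3"
      by (meson continuous_map_in_subtopology homeomorphic_imp_continuous_map)
    have "continuous_map (subtopology (prod_topology G G) ?T) G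
        (\<phi>3 \<circ> (?m \<circ> (\<lambda>p. (\<psi>1 (fst p), \<psi>2 (snd p)))))"
      by (rule continuous_map_compose[OF continuous_map_compose[OF c1 c2] c3])
    then have "continuous_map (subtopology (prod_topology G G) ?T) G (\<lambda>(g, h). g ** h)"
    proof (rule continuous_map_eq)
      fix q assume "q \<in> topspace (subtopology (prod_topology G G) ?T)"
      then obtain a b where ab: "a \<in> W1" "b \<in> W2" "q = (\<phi>1 a, \<phi>2 b)"
        by auto
      show "(\<phi>3 \<circ> (?m \<circ> (\<lambda>p. (\<psi>1 (fst p), \<psi>2 (snd p))))) q = (case q of (g, h) \<Rightarrow> g ** h)"
        using ab prod \<psi>1(2) \<psi>2(2) by (simp add: f_inv_into_f)
    qed
    moreover have "openin (prod_topology G G) ?T"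
      using lp by (simp add: openin_prod_Times_iff local_param_def)
    ultimately show ?thesis
      using mem gh by auto
  qed
  then obtain T where T: "\<forall>p\<in>topspace (prod_topology G G). openin (prod_topology G G) (T p) \<and>
      p \<in> T p \<and> continuous_map (subtopology (prod_topology G G) (T p)) G (\<lambda>(g, h). g ** h)"
    by metis
  show ?thesis
    by (rule pasting_lemma[where I = "topspace (prod_topology G G)" and T = T and
          f = "\<lambda>_ (g, h). g ** h"]) (use T in auto)
qed

lemma zero_in_lie_algebra:
  assumes "lie_subgroup G"
  shows "0 \<in> lie_algebra G"
proof -
  have "mat 1 \<in> topspace G"
    using assms by (simp add: lie_subgroup_def)
  then show ?thesis
    unfolding lie_algebra_def tangent_space_def
    by (intro CollectI exI[of _ 1] conjI exI[of _ "\<lambda>_. mat 1"])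
      (auto intro: smooth_on_const)
qed

text \<open>Running a curve at speed \<open>c\<close> multiplies its velocity by \<open>c\<close>.\<close>

lemma lie_algebra_scaleR:
  assumes "A \<in> lie_algebra G"
  shows "c *\<^sub>R A \<in> lie_algebra G"
proof -
  obtain e \<gamma> where e: "e > 0" and \<gamma>: "continuous_map (top_of_set {-e<..<e}) G \<gamma>"
      "smooth_on {-e<..<e} \<gamma>" "\<gamma> 0 = mat 1" "(\<gamma> has_vector_derivative A) (at 0)"
    using assms unfolding lie_algebra_def tangent_space_def by blast
  \<comment> \<open>The summand 1 keeps the new radius positive, also for \<open>c = 0\<close>.\<close>
  define d where "d = e / (\<bar>c\<bar> + 1)"
  have "d > 0"
    using e by (simp add: d_def)
  have sub: "c * t \<in> {-e<..<e}" if "t \<in> {-d<..<d}" for t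
  proof -
    have "\<bar>c\<bar> * \<bar>t\<bar> \<le> (\<bar>c\<bar> + 1) * \<bar>t\<bar>"
      by (simp add: algebra_simps)
    also have "\<dots> < (\<bar>c\<bar> + 1) * d"
      using that by (intro mult_strict_left_mono) auto
    also have "\<dots> = e"
      by (simp add: d_def)
    finally show ?thesis
      by (simp add: abs_mult[symmetric] abs_less_iff)
  qed
  have "continuous_map (top_of_set {-d<..<d}) (top_of_set {-e<..<e}) (\<lambda>t. c * t)"
    using sub by (auto simp: continuous_map_in_subtopology intro!: continuous_intros)
  from continuous_map_compose[OF this \<gamma>(1)]
  have 1: "continuous_map (top_of_set {-d<..<d}) G (\<lambda>t. \<gamma> (c * t))"
    by (simp add: o_def)
  have 2: "smooth_on {-d<..<d} (\<lambda>t. \<gamma> (c * t))"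
    using smooth_on_compose_linear[OF \<gamma>(2) bounded_linear_mult_right[of c]]
    by (rule smooth_on_subset) (use sub in auto)
  have 3: "((\<lambda>t. \<gamma> (c * t)) has_vector_derivative c *\<^sub>R A) (at 0)"
  proof -
    have "((\<lambda>t. c * t) has_vector_derivative c) (at 0)"
      by (auto intro!: derivative_eq_intros simp: has_real_derivative_iff_has_vector_derivative[symmetric])
    moreover have "(\<gamma> has_vector_derivative A) (at (c * 0))"
      using \<gamma>(4) by simp
    ultimately show ?thesis
      using vector_diff_chain_at[of "\<lambda>t. c * t" c 0 \<gamma> A] by (simp add: o_def)
  qed
  show ?thesis
    unfolding lie_algebra_def tangent_space_def
    using \<open>d > 0\<close> 1 2 3 \<gamma>(3) by (intro CollectI exI[of _ d] conjI exI[of _ "\<lambda>t. \<gamma> (c * t)"]) auto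
qed

text \<open>By the product rule at the identity, the product of two curves has the sum of their
  velocities.\<close>

lemma lie_algebra_add:
  assumes G: "lie_subgroup G" and A: "A \<in> lie_algebra G" and B: "B \<in> lie_algebra G"
  shows "A + B \<in> lie_algebra G"
proof -
  obtain e1 \<gamma>1 where e1: "e1 > 0" and \<gamma>1: "continuous_map (top_of_set {-e1<..<e1}) G \<gamma>1"
      "smooth_on {-e1<..<e1} \<gamma>1" "\<gamma>1 0 = mat 1" "(\<gamma>1 has_vector_derivative A) (at 0)"
    using A unfolding lie_algebra_def tangent_space_def by blast
  obtain e2 \<gamma>2 where e2: "e2 > 0" and \<gamma>2: "continuous_map (top_of_set {-e2<..<e2}) G \<gamma>2"
      "smooth_on {-e2<..<e2} \<gamma>2" "\<gamma>2 0 = mat 1" "(\<gamma>2 has_vector_derivative B) (at 0)"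
    using B unfolding lie_algebra_def tangent_space_def by blast
  define e where "e = min e1 e2"
  have "e > 0" and sub: "{-e<..<e} \<subseteq> {-e1<..<e1}" "{-e<..<e} \<subseteq> {-e2<..<e2}"
    using e1 e2 by (auto simp: e_def)
  have "continuous_map (top_of_set {-e<..<e}) G \<gamma>1" "continuous_map (top_of_set {-e<..<e}) G \<gamma>2"
    using \<gamma>1(1) \<gamma>2(1) sub continuous_map_from_subtopology_mono by blast+
  then have "continuous_map (top_of_set {-e<..<e}) (prod_topology G G) (\<lambda>t. (\<gamma>1 t, \<gamma>2 t))"
    by (rule continuous_map_pairedI)
  from continuous_map_compose[OF this lie_subgroup_mult_continuous[OF G]]
  have 1: "continuous_map (top_of_set {-e<..<e}) G (\<lambda>t. \<gamma>1 t ** \<gamma>2 t)"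
    by (simp add: o_def)
  have 2: "smooth_on {-e<..<e} (\<lambda>t. \<gamma>1 t ** \<gamma>2 t)"
    by (rule smooth_on_bounded_bilinear[OF smooth_on_subset[OF \<gamma>1(2) sub(1)]
          smooth_on_subset[OF \<gamma>2(2) sub(2)] bounded_bilinear_matrix_matrix_mult])
  have 3: "((\<lambda>t. \<gamma>1 t ** \<gamma>2 t) has_vector_derivative A + B) (at 0)"
    using bounded_bilinear.has_vector_derivative[OF bounded_bilinear_matrix_matrix_mult \<gamma>1(4) \<gamma>2(4)]
    by (simp add: \<gamma>1(3) \<gamma>2(3) add.commute)
  show ?thesis
    unfolding lie_algebra_def tangent_space_def
    using \<open>e > 0\<close> 1 2 3 \<gamma>1(3) \<gamma>2(3)
    by (intro CollectI exI[of _ e] conjI exI[of _ "\<lambda>t. \<gamma>1 t ** \<gamma>2 t"]) auto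
qed

lemma subspace_lie_algebra: "lie_subgroup G \<Longrightarrow> subspace (lie_algebra G)"
  by (simp add: subspace_def zero_in_lie_algebra lie_algebra_add lie_algebra_scaleR)

lemma subspace_sym_part:
  assumes "subspace S"
  shows "subspace (sym_part S)"
  using assms by (auto simp: sym_part_def subspace_def transpose_def vec_eq_iff)


section \<open>The quadratic map\<close>

lemma orth_proj_works:
  fixes x :: "'a::euclidean_space"
  assumes S: "subspace S"
  shows "orth_proj S x \<in> S \<and> (\<forall>z\<in>S. (x - orth_proj S x) \<bullet> z = 0)"
  unfolding orth_proj_def
proof (rule theI')
  obtain y z where yz: "y \<in> span S" "\<And>w. w \<in> span S \<Longrightarrow> orthogonal z w" "x = y + z"
    using orthogonal_subspace_decomp_exists[of S x] by blast
  show "\<exists>!y. y \<in> S \<and> (\<forall>z\<in>S. (x - y) \<bullet> z = 0)"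
  proof (rule ex1I)
    show "y \<in> S \<and> (\<forall>z\<in>S. (x - y) \<bullet> z = 0)"
      using yz S by (auto simp: orthogonal_def span_eq_iff[THEN iffD2])
  next
    fix y' assume y': "y' \<in> S \<and> (\<forall>z\<in>S. (x - y') \<bullet> z = 0)"
    have "y - y' \<in> S"
      using yz(1) y' S by (metis span_eq_iff subspace_diff)
    then have "(y - y') \<bullet> (y - y') = 0"
      using y' yz by (metis (no_types, lifting) S add_diff_cancel_left' diff_add_cancel inner_diff_left
          orthogonal_def span_eq_iff eq_iff_diff_eq_0 add_diff_cancel_right' diff_diff_eq2)
    then show "y' = y"
      by simp
  qed
qed

lemma orth_proj_eqI:
  fixes x :: "'a::euclidean_space"
  assumes S: "subspace S" and "y \<in> S" "\<And>z. z \<in> S \<Longrightarrow> (x - y) \<bullet> z = 0"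
  shows "orth_proj S x = y"
proof -
  let ?p = "orth_proj S x"
  have "?p - y \<in> S"
    using orth_proj_works[OF S, of x] assms(2) S by (simp add: subspace_diff)
  then have "(x - y) \<bullet> (?p - y) = 0" "(x - ?p) \<bullet> (?p - y) = 0"
    using orth_proj_works[OF S, of x] assms(3) by auto
  then have "(?p - y) \<bullet> (?p - y) = 0"
    by (simp add: inner_diff_left)
  then show ?thesis
    by simp
qed

lemma linear_orth_proj:
  fixes S :: "'a::euclidean_space set"
  assumes S: "subspace S"
  shows "linear (orth_proj S)"
proof (rule linearI)
  note P = orth_proj_works[OF S]
  show "orth_proj S (x + y) = orth_proj S x + orth_proj S y" for x y
  proof (rule orth_proj_eqI[OF S])
    show "orth_proj S x + orth_proj S y \<in> S"
      using P S by (simp add: subspace_add)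
    show "(x + y - (orth_proj S x + orth_proj S y)) \<bullet> z = 0" if "z \<in> S" for z
      using P[of x] P[of y] that by (simp add: inner_diff_left inner_add_left)
  qed
  show "orth_proj S (c *\<^sub>R x) = c *\<^sub>R orth_proj S x" for c x
  proof (rule orth_proj_eqI[OF S])
    show "c *\<^sub>R orth_proj S x \<in> S"
      using P S by (simp add: subspace_scale)
    show "(c *\<^sub>R x - c *\<^sub>R orth_proj S x) \<bullet> z = 0" if "z \<in> S" for z
      using P[of x] that by (simp add: inner_diff_left flip: right_diff_distrib)
  qed
qed

definition outer_product :: "real ^ 'n \<Rightarrow> real ^ 'n \<Rightarrow> real ^ 'n ^ 'n" where
  "outer_product x y = (\<chi> i j. x $ i * y $ j)"

lemma inner_outer_product: "A \<bullet> outer_product x y = x \<bullet> (A *v y)"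
  by (simp add: outer_product_def inner_vec_def matrix_vector_mult_def sum_distrib_left mult_ac)

text \<open>A bilinear map with \<open>C\<close> on its diagonal. It is left unsymmetrized: the mixed terms of
  \<open>C (x + v)\<close> are \<open>polar_C G x v + polar_C G v x\<close>.\<close>

definition polar_C :: "(real ^ 'n ^ 'n) topology \<Rightarrow> real ^ 'n \<Rightarrow> real ^ 'n \<Rightarrow> real ^ 'n ^ 'n" where
  "polar_C G x y = orth_proj (sym_part (lie_algebra G)) (outer_product x y)"

lemma C_map_eq_polar: "C_map G x = polar_C G x x"
  by (simp add: C_map_def polar_C_def outer_product_def)

lemma bounded_bilinear_polar_C:
  assumes "lie_subgroup G"
  shows "bounded_bilinear (polar_C G)"
proof -
  let ?S = "sym_part (lie_algebra G)"
  have P: "linear (orth_proj ?S)"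
    using assms by (simp add: linear_orth_proj subspace_sym_part subspace_lie_algebra)
  have "linear (\<lambda>y. outer_product x y)" and "linear (\<lambda>x. outer_product x y)"
    for x y :: "real ^ 'n"
    by (auto intro!: linearI simp: outer_product_def vec_eq_iff algebra_simps)
  then have "bilinear (polar_C G)"
    using linear_compose[OF _ P] by (auto simp: bilinear_def polar_C_def o_def)
  then show ?thesis
    by (simp add: bilinear_conv_bounded_bilinear)
qed

lemma C_map_has_derivative:
  assumes "lie_subgroup G"
  shows "(C_map G has_derivative (\<lambda>v. polar_C G x v + polar_C G v x)) (at x)"
  unfolding C_map_eq_polar[abs_def]
  using bounded_bilinear.FDERIV[OF bounded_bilinear_polar_C[OF assms] has_derivative_ident has_derivative_ident] .

text \<open>The symmetric matrix \<open>x v\<^sup>T + v x\<^sup>T\<close> is orthogonal to every symmetric \<open>A\<close> with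
  \<open>v \<bullet> (A x) = 0\<close>, so the projection kills it.\<close>

lemma polar_C_cross_term_eq_0:
  assumes G: "lie_subgroup G" and orth: "\<And>A. A \<in> sym_part (lie_algebra G) \<Longrightarrow> v \<bullet> (A *v x) = 0"
  shows "polar_C G x v + polar_C G v x = 0"
proof -
  let ?S = "sym_part (lie_algebra G)"
  have S: "subspace ?S"
    using G by (simp add: subspace_sym_part subspace_lie_algebra)
  have "orth_proj ?S (outer_product x v + outer_product v x) = 0"
  proof (rule orth_proj_eqI[OF S])
    show "0 \<in> ?S"
      using S by (simp add: subspace_0)
    fix A assume A: "A \<in> ?S"
    then have "x \<bullet> (A *v v) = (A *v x) \<bullet> v"
      by (metis (mono_tags, lifting) dot_lmul_matrix mem_Collect_eq sym_part_def transpose_matrix_vector)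
    then show "(outer_product x v + outer_product v x - 0) \<bullet> A = 0"
      using orth[OF A] by (simp add: inner_commute[of _ A] inner_add_right inner_outer_product)
        (simp add: inner_commute)
  qed
  then show ?thesis
    using linear_add[OF linear_orth_proj[OF S]] by (simp add: polar_C_def)
qed


section \<open>Subgradients are orthogonal to orbits\<close>

text \<open>Along a curve on which \<open>f\<close> is constant, the subgradient inequality reads
  \<open>v \<bullet> (y t - x) \<le> o(\<bar>y t - x\<bar>)\<close>; dividing by \<open>t > 0\<close> and letting \<open>t\<close> tend to 0 gives the claim.\<close>

lemma regular_subdiff_level_curve:
  fixes f :: "'a::euclidean_space \<Rightarrow> ereal"
  assumes v: "v \<in> regular_subdiff f x"
    and y: "(y has_vector_derivative D) (at 0)" "y 0 = x"
    and level: "\<forall>\<^sub>F t in at_right (0::real). f (y t) = f x"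
  shows "v \<bullet> D \<le> 0"
proof (rule field_le_epsilon)
  fix \<epsilon> :: real assume "\<epsilon> > 0"
  obtain r where fin: "\<bar>f x\<bar> \<noteq> \<infinity>" and r: "r \<in> o[at x](\<lambda>z. norm (z - x))"
    and ineq: "\<forall>\<^sub>F z in at x. f z \<ge> f x + ereal (v \<bullet> (z - x) + r z)"
    using v unfolding regular_subdiff_def by auto
  define e where "e = \<epsilon> / (norm D + 1)"
  have "e > 0"
    using \<open>\<epsilon> > 0\<close> by (auto simp: e_def intro!: divide_pos_pos add_nonneg_pos)
  have "\<forall>\<^sub>F z in at x. norm (r z) \<le> e * norm (norm (z - x))"
    using landau_o.smallD[OF r \<open>e > 0\<close>] .
  with ineq have "\<forall>\<^sub>F z in at x. f z = f x \<longrightarrow> v \<bullet> (z - x) \<le> e * norm (z - x)"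
  proof eventually_elim
    case (elim z)
    show ?case
    proof
      assume "f z = f x"
      then have "v \<bullet> (z - x) + r z \<le> 0"
        using elim(1) fin by (cases "f x") auto
      then show "v \<bullet> (z - x) \<le> e * norm (z - x)"
        using elim(2) by simp
    qed
  qed
  then have near: "\<forall>\<^sub>F z in nhds x. f z = f x \<longrightarrow> v \<bullet> (z - x) \<le> e * norm (z - x)"
    unfolding eventually_at_filter by eventually_elim auto
  have "continuous (at 0) y"
    using y(1) has_vector_derivative_continuous by blast
  then have "(y \<longlongrightarrow> x) (at_right 0)"
    using y(2) by (metis continuous_within tendsto_within_subset top_greatest)
  then have "\<forall>\<^sub>F t in at_right 0. f (y t) = f x \<longrightarrow> v \<bullet> (y t - x) \<le> e * norm (y t - x)"
    using near filterlim_iff by blast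
  with level have key: "\<forall>\<^sub>F t in at_right 0. v \<bullet> ((y t - x) /\<^sub>R t) \<le> e * norm ((y t - x) /\<^sub>R t)"
    using eventually_at_right_less[of "0::real"]
  proof eventually_elim
    case (elim t)
    then have "inverse t * (v \<bullet> (y t - x)) \<le> inverse t * (e * norm (y t - x))"
      by (intro mult_left_mono) auto
    then show ?case
      using elim(3) by (simp add: mult_ac)
  qed
  have "((\<lambda>t. (1 / norm (t - 0)) *\<^sub>R (y t - (y 0 + (t - 0) *\<^sub>R D))) \<longlongrightarrow> 0) (at_right 0)"
    using has_vector_derivative_at_within[OF y(1), of "{0<..}"]
    by (simp add: has_vector_derivative_def has_derivative_within)
  moreover have "\<forall>\<^sub>F t in at_right 0.
      (1 / norm (t - 0)) *\<^sub>R (y t - (y 0 + (t - 0) *\<^sub>R D)) = (y t - x) /\<^sub>R t - D"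
    using eventually_at_right_less[of "0::real"]
    by eventually_elim (simp add: y(2) algebra_simps inverse_eq_divide)
  ultimately have "((\<lambda>t. (y t - x) /\<^sub>R t - D) \<longlongrightarrow> 0) (at_right 0)"
    by (rule Lim_transform_eventually)
  then have "((\<lambda>t. (y t - x) /\<^sub>R t) \<longlongrightarrow> D) (at_right 0)"
    by (rule LIM_zero_cancel)
  then have "((\<lambda>t. v \<bullet> ((y t - x) /\<^sub>R t)) \<longlongrightarrow> v \<bullet> D) (at_right 0)"
    and "((\<lambda>t. e * norm ((y t - x) /\<^sub>R t)) \<longlongrightarrow> e * norm D) (at_right 0)"
    by (intro tendsto_intros; assumption)+
  then have "v \<bullet> D \<le> e * norm D"
    using key by (intro tendsto_le[of "at_right (0::real)"]) auto
  also have "\<dots> \<le> e * (norm D + 1)"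
    using \<open>e > 0\<close> by simp
  also have "\<dots> = \<epsilon>"
    using norm_ge_zero[of D] by (simp add: e_def add_nonneg_eq_0_iff)
  finally show "v \<bullet> D \<le> 0 + \<epsilon>"
    by simp
qed

lemma regular_subdiff_orthogonal_orbit:
  fixes f :: "real ^ 'n \<Rightarrow> ereal"
  assumes inv: "\<forall>g\<in>topspace G. \<forall>x. f (g *v x) = f x"
    and A: "A \<in> lie_algebra G" and v: "v \<in> regular_subdiff f x"
  shows "v \<bullet> (A *v x) = 0"
proof -
  have le: "v \<bullet> (B *v x) \<le> 0" if B: "B \<in> lie_algebra G" for B
  proof -
    obtain e \<gamma> where e: "e > 0" and \<gamma>: "continuous_map (top_of_set {-e<..<e}) G \<gamma>"
        "\<gamma> 0 = mat 1" "(\<gamma> has_vector_derivative B) (at 0)"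
      using B unfolding lie_algebra_def tangent_space_def by blast
    have "bounded_linear (\<lambda>g. g *v x)"
      by (auto intro!: linearI simp: linear_conv_bounded_linear[symmetric]
          matrix_vector_mult_add_rdistrib scaleR_matrix_vector_assoc)
    then have "((\<lambda>t. \<gamma> t *v x) has_vector_derivative B *v x) (at 0)"
      using \<gamma>(3) by (rule bounded_linear.has_vector_derivative)
    moreover have "\<forall>\<^sub>F t in at_right 0. f (\<gamma> t *v x) = f x"
      using eventually_at_right_real[OF e]
    proof eventually_elim
      case (elim t)
      then have "\<gamma> t \<in> topspace G"
        using continuous_map_image_subset_topspace[OF \<gamma>(1)] by force
      then show ?case
        using inv by simp
    qed
    ultimately show ?thesis
      using regular_subdiff_level_curve[OF v, of "\<lambda>t. \<gamma> t *v x"] \<gamma>(2) by simp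
  qed
  from le[OF lie_algebra_scaleR[OF A, of "-1"]] le[OF A] show ?thesis
    using scaleR_matrix_vector_assoc[of "-1" A x, symmetric] by simp
qed

lemma subdiff_orthogonal_orbit:
  fixes f :: "real ^ 'n \<Rightarrow> ereal"
  assumes inv: "\<forall>g\<in>topspace G. \<forall>x. f (g *v x) = f x"
    and A: "A \<in> lie_algebra G" and v: "v \<in> subdiff f x"
  shows "v \<bullet> (A *v x) = 0"
proof -
  obtain y w where yw: "\<forall>k. w k \<in> regular_subdiff f (y k)" "y \<longlonglongrightarrow> x" "w \<longlonglongrightarrow> v"
    using v unfolding subdiff_def by blast
  have "(\<lambda>k. w k \<bullet> (A *v y k)) \<longlonglongrightarrow> v \<bullet> (A *v x)"
    using yw by (intro tendsto_inner bounded_linear.tendsto[OF matrix_vector_mul_bounded_linear]) auto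
  moreover have "w k \<bullet> (A *v y k) = 0" for k
    using regular_subdiff_orthogonal_orbit[OF inv A] yw(1) by blast
  ultimately show ?thesis
    by (simp add: LIMSEQ_const_iff)
qed

lemma horizon_subdiff_orthogonal_orbit:
  fixes f :: "real ^ 'n \<Rightarrow> ereal"
  assumes inv: "\<forall>g\<in>topspace G. \<forall>x. f (g *v x) = f x"
    and A: "A \<in> lie_algebra G" and v: "v \<in> horizon_subdiff f x"
  shows "v \<bullet> (A *v x) = 0"
proof -
  obtain y w \<tau> where yw: "\<forall>k. w k \<in> regular_subdiff f (y k)" "y \<longlonglongrightarrow> x"
      "(\<lambda>k. (\<tau> k :: real) *\<^sub>R w k) \<longlonglongrightarrow> v"
    using v unfolding horizon_subdiff_def by blast
  have "(\<lambda>k. (\<tau> k *\<^sub>R w k) \<bullet> (A *v y k)) \<longlonglongrightarrow> v \<bullet> (A *v x)"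
    using yw by (intro tendsto_inner bounded_linear.tendsto[OF matrix_vector_mul_bounded_linear]) auto
  moreover have "(\<tau> k *\<^sub>R w k) \<bullet> (A *v y k) = 0" for k
    using regular_subdiff_orthogonal_orbit[OF inv A, of "w k" "y k"] yw(1) by simp
  ultimately show ?thesis
    by (metis (no_types, lifting) LIMSEQ_unique ext tendsto_const)
qed

text \<open>The orthogonal complement of \<open>A x\<close> is a closed convex set containing all sums of limiting and
  horizon subgradients.\<close>

lemma clarke_subdiff_orthogonal_orbit:
  fixes f :: "real ^ 'n \<Rightarrow> ereal"
  assumes inv: "\<forall>g\<in>topspace G. \<forall>x. f (g *v x) = f x"
    and A: "A \<in> lie_algebra G" and v: "v \<in> clarke_subdiff f x"
  shows "v \<bullet> (A *v x) = 0"
proof -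
  let ?H = "{v. (A *v x) \<bullet> v = 0}"
  have "{u + w | u w. u \<in> subdiff f x \<and> w \<in> horizon_subdiff f x} \<subseteq> ?H"
    using subdiff_orthogonal_orbit[OF inv A] horizon_subdiff_orthogonal_orbit[OF inv A]
    by (auto simp: inner_add_right inner_commute)
  then have "convex hull {u + w | u w. u \<in> subdiff f x \<and> w \<in> horizon_subdiff f x} \<subseteq> ?H"
    by (intro hull_minimal convex_hyperplane)
  then have "clarke_subdiff f x \<subseteq> ?H"
    unfolding clarke_subdiff_def by (intro closure_minimal closed_hyperplane)
  then show ?thesis
    using v by (auto simp: inner_commute)
qed

lemma clarke_subdiff_cross_term_eq_0:
  assumes "lie_subgroup G" and "\<forall>g\<in>topspace G. \<forall>x. f (g *v x) = f x"
    and "v \<in> clarke_subdiff f x"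
  shows "polar_C G x v + polar_C G v x = 0"
  using assms clarke_subdiff_orthogonal_orbit
  by (intro polar_C_cross_term_eq_0) (auto simp: sym_part_def)


section \<open>Absolutely continuous curves\<close>

lemma abs_continuous_onE:
  assumes "abs_continuous_on a b x" "\<epsilon> > 0"
  obtains \<delta> where "\<delta> > 0" "\<And>P. finite P \<and> (\<forall>(s, t)\<in>P. a \<le> s \<and> s \<le> t \<and> t \<le> b) \<and>
      pairwise (\<lambda>(s, t) (s', t'). disjnt {s<..<t} {s'<..<t'}) P \<and>
      (\<Sum>(s, t)\<in>P. t - s) < \<delta> \<Longrightarrow> (\<Sum>(s, t)\<in>P. norm (x t - x s)) < \<epsilon>"
proof -
  obtain \<delta> where \<delta>: "\<delta> > 0" "\<forall>P. finite P \<and> (\<forall>(s, t)\<in>P. a \<le> s \<and> s \<le> t \<and> t \<le> b) \<and>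
      pairwise (\<lambda>(s, t) (s', t'). disjnt {s<..<t} {s'<..<t'}) P \<and>
      (\<Sum>(s, t)\<in>P. t - s) < \<delta> \<longrightarrow> (\<Sum>(s, t)\<in>P. norm (x t - x s)) < \<epsilon>"
    using mp[OF spec[OF assms(1)[unfolded abs_continuous_on_def]] assms(2)] by (elim exE conjE)
  show thesis
    by (rule that[OF \<delta>(1)]) (rule \<delta>(2)[rule_format])
qed

lemma abs_continuous_on_subinterval:
  assumes "abs_continuous_on a b x" "a \<le> c" "d \<le> b"
  shows "abs_continuous_on c d x"
  unfolding abs_continuous_on_def
proof (intro allI impI)
  fix \<epsilon> :: real assume "\<epsilon> > 0"
  obtain \<delta> where \<delta>: "\<delta> > 0" "\<And>P. finite P \<and> (\<forall>(s, t)\<in>P. a \<le> s \<and> s \<le> t \<and> t \<le> b) \<and>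
      pairwise (\<lambda>(s, t) (s', t'). disjnt {s<..<t} {s'<..<t'}) P \<and>
      (\<Sum>(s, t)\<in>P. t - s) < \<delta> \<Longrightarrow> (\<Sum>(s, t)\<in>P. norm (x t - x s)) < \<epsilon>"
    using abs_continuous_onE[OF assms(1) \<open>\<epsilon> > 0\<close>] by blast
  show "\<exists>\<delta>>0. \<forall>P. finite P \<and> (\<forall>(s, t)\<in>P. c \<le> s \<and> s \<le> t \<and> t \<le> d) \<and>
      pairwise (\<lambda>(s, t) (s', t'). disjnt {s<..<t} {s'<..<t'}) P \<and>
      (\<Sum>(s, t)\<in>P. t - s) < \<delta> \<longrightarrow> (\<Sum>(s, t)\<in>P. norm (x t - x s)) < \<epsilon>"
    using assms(2,3) by (intro exI[of _ \<delta>] conjI allI impI \<delta>) fastforce+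
qed

lemma abs_continuous_on_imp_continuous_on:
  assumes "abs_continuous_on a b x"
  shows "continuous_on {a..b} x"
  unfolding continuous_on_iff
proof (intro ballI allI impI)
  fix t \<epsilon> :: real assume t: "t \<in> {a..b}" and "\<epsilon> > 0"
  obtain \<delta> where \<delta>: "\<delta> > 0" "\<And>P. finite P \<and> (\<forall>(s, t)\<in>P. a \<le> s \<and> s \<le> t \<and> t \<le> b) \<and>
      pairwise (\<lambda>(s, t) (s', t'). disjnt {s<..<t} {s'<..<t'}) P \<and>
      (\<Sum>(s, t)\<in>P. t - s) < \<delta> \<Longrightarrow> (\<Sum>(s, t)\<in>P. norm (x t - x s)) < \<epsilon>"
    using abs_continuous_onE[OF assms \<open>\<epsilon> > 0\<close>] by blast
  have "dist (x s) (x t) < \<epsilon>" if "s \<in> {a..b}" "dist s t < \<delta>" for s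
  proof (cases "s \<le> t")
    case True
    then show ?thesis
      using \<delta>(2)[of "{(s, t)}"] that t by (simp add: dist_norm norm_minus_commute)
  next
    case False
    then show ?thesis
      using \<delta>(2)[of "{(t, s)}"] that t by (simp add: dist_norm)
  qed
  then show "\<exists>d>0. \<forall>s\<in>{a..b}. dist s t < d \<longrightarrow> dist (x s) (x t) < \<epsilon>"
    using \<delta>(1) by blast
qed

lemma abs_continuous_on_lipschitz_image:
  assumes x: "abs_continuous_on a b x"
    and lip: "\<And>s t. s \<in> {a..b} \<Longrightarrow> t \<in> {a..b} \<Longrightarrow> norm (y t - y s) \<le> L * norm (x t - x s)"
  shows "abs_continuous_on a b y"
  unfolding abs_continuous_on_def
proof (intro allI impI)
  fix \<epsilon> :: real assume "\<epsilon> > 0"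
  define K where "K = \<bar>L\<bar> + 1"
  have "K > 0"
    by (simp add: K_def add_nonneg_pos)
  obtain \<delta> where \<delta>: "\<delta> > 0" "\<And>P. finite P \<and> (\<forall>(s, t)\<in>P. a \<le> s \<and> s \<le> t \<and> t \<le> b) \<and>
      pairwise (\<lambda>(s, t) (s', t'). disjnt {s<..<t} {s'<..<t'}) P \<and>
      (\<Sum>(s, t)\<in>P. t - s) < \<delta> \<Longrightarrow> (\<Sum>(s, t)\<in>P. norm (x t - x s)) < \<epsilon> / K"
    using abs_continuous_onE[OF x divide_pos_pos[OF \<open>\<epsilon> > 0\<close> \<open>K > 0\<close>]] by blast
  show "\<exists>\<delta>>0. \<forall>P. finite P \<and> (\<forall>(s, t)\<in>P. a \<le> s \<and> s \<le> t \<and> t \<le> b) \<and>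
      pairwise (\<lambda>(s, t) (s', t'). disjnt {s<..<t} {s'<..<t'}) P \<and>
      (\<Sum>(s, t)\<in>P. t - s) < \<delta> \<longrightarrow> (\<Sum>(s, t)\<in>P. norm (y t - y s)) < \<epsilon>"
  proof (intro exI[of _ \<delta>] conjI allI impI \<delta>(1))
    fix P :: "(real \<times> real) set"
    assume P: "finite P \<and> (\<forall>(s, t)\<in>P. a \<le> s \<and> s \<le> t \<and> t \<le> b) \<and>
      pairwise (\<lambda>(s, t) (s', t'). disjnt {s<..<t} {s'<..<t'}) P \<and> (\<Sum>(s, t)\<in>P. t - s) < \<delta>"
    have "(\<Sum>(s, t)\<in>P. norm (y t - y s)) \<le> (\<Sum>(s, t)\<in>P. K * norm (x t - x s))"
    proof (rule sum_mono, clarify)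
      fix s t assume "(s, t) \<in> P"
      then have "s \<in> {a..b}" "t \<in> {a..b}"
        using P by force+
      from lip[OF this] show "norm (y t - y s) \<le> K * norm (x t - x s)"
        by (rule order_trans) (simp add: K_def mult_right_mono)
    qed
    also have "\<dots> = K * (\<Sum>(s, t)\<in>P. norm (x t - x s))"
      by (simp add: sum_distrib_left case_prod_unfold)
    also have "\<dots> < K * (\<epsilon> / K)"
      using \<delta>(2)[OF P] \<open>K > 0\<close> by (rule mult_strict_left_mono)
    finally show "(\<Sum>(s, t)\<in>P. norm (y t - y s)) < \<epsilon>"
      using \<open>K > 0\<close> by simp
  qed
qed

text \<open>A quadratic map is Lipschitz on the bounded range of the curve.\<close>

lemma abs_continuous_on_quadratic:
  assumes B: "bounded_bilinear B" and x: "abs_continuous_on a b x"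
  shows "abs_continuous_on a b (\<lambda>t. B (x t) (x t))"
proof -
  interpret bounded_bilinear B by (rule B)
  obtain K where K: "K > 0" "\<And>u v. norm (B u v) \<le> norm u * norm v * K"
    using pos_bounded by blast
  have "bounded (x ` {a..b})"
    using abs_continuous_on_imp_continuous_on[OF x]
    by (simp add: compact_continuous_image compact_imp_bounded)
  then obtain M where M: "\<And>t. t \<in> {a..b} \<Longrightarrow> norm (x t) \<le> M"
    unfolding bounded_iff by (metis imageI)
  show ?thesis
  proof (rule abs_continuous_on_lipschitz_image[OF x])
    fix s t assume st: "s \<in> {a..b}" "t \<in> {a..b}"
    have "B (x t) (x t) - B (x s) (x s) = B (x t - x s) (x t) + B (x s) (x t - x s)"
      by (simp add: diff_left diff_right)
    also have "norm \<dots> \<le> norm (x t - x s) * norm (x t) * K + norm (x s) * norm (x t - x s) * K"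
      by (intro norm_triangle_le add_mono K)
    also have "\<dots> = K * (norm (x t) + norm (x s)) * norm (x t - x s)"
      by (simp add: algebra_simps)
    also have "\<dots> \<le> K * (M + M) * norm (x t - x s)"
      using M st K(1) by (intro mult_right_mono mult_left_mono add_mono) auto
    finally show "norm (B (x t) (x t) - B (x s) (x s)) \<le> K * (M + M) * norm (x t - x s)" .
  qed
qed

text \<open>Choose a gauge such that intervals tagged by a good point (derivative zero) contribute at most
  \<open>\<epsilon>\<close> times their length to the increment, while intervals tagged by a point of the exceptional set
  lie in an open set of measure less than the \<open>\<delta>\<close> of absolute continuity, so that together they
  contribute less than \<open>\<epsilon>\<close>. A fine division of the interval then bounds the total increment.\<close>

lemma abs_continuous_on_derivative_zero_AE_imp_eq:
  fixes h :: "real \<Rightarrow> 'a::real_normed_vector"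
  assumes ab: "a \<le> b" and ac: "abs_continuous_on a b h" and N: "negligible N"
    and der: "\<And>t. t \<in> {a..b} - N \<Longrightarrow> (h has_vector_derivative 0) (at t)"
  shows "h b = h a"
proof -
  have "norm (h b - h a) \<le> 0 + \<eta>" if "\<eta> > 0" for \<eta>
  proof -
    \<comment> \<open>Good cells contribute at most \<open>\<epsilon> (b - a)\<close>, bad ones less than \<open>\<epsilon>\<close>.\<close>
    define \<epsilon> where "\<epsilon> = \<eta> / (b - a + 1)"
    have "\<epsilon> > 0"
      using \<open>\<eta> > 0\<close> ab by (simp add: \<epsilon>_def)
    obtain \<delta> where \<delta>: "\<delta> > 0" "\<And>P. finite P \<and> (\<forall>(s, t)\<in>P. a \<le> s \<and> s \<le> t \<and> t \<le> b) \<and>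
        pairwise (\<lambda>(s, t) (s', t'). disjnt {s<..<t} {s'<..<t'}) P \<and>
        (\<Sum>(s, t)\<in>P. t - s) < \<delta> \<Longrightarrow> (\<Sum>(s, t)\<in>P. norm (h t - h s)) < \<epsilon>"
      using abs_continuous_onE[OF ac \<open>\<epsilon> > 0\<close>] by blast
    have N0: "N \<in> null_sets lebesgue"
      using N by (simp add: negligible_iff_null_sets)
    obtain O' where O': "open O'" "N \<subseteq> O'" "O' - N \<in> lmeasurable"
        "emeasure lebesgue (O' - N) < ennreal \<delta>"
      using sets_lebesgue_outer_open[of N \<delta>] N0 \<delta>(1) by auto
    have emO: "emeasure lebesgue O' < ennreal \<delta>"
      using O'(1,4) N0 by (simp add: emeasure_Diff_null_set borel_open)
    then have Olm: "O' \<in> lmeasurable"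
      using O'(1) by (intro fmeasurableI) (auto simp: borel_open intro: less_trans)
    then have mO: "measure lebesgue O' < \<delta>"
      using emO \<delta>(1) by (simp add: emeasure_eq_measure2 ennreal_less_iff)
    have "\<exists>d>0. if t \<in> N then ball t d \<subseteq> O' else
        (t \<in> {a..b} \<longrightarrow> (\<forall>s\<in>ball t d. norm (h s - h t) \<le> \<epsilon> * \<bar>s - t\<bar>))" for t
    proof (cases "t \<in> N")
      case True
      then show ?thesis
        using O' openE by (metis subsetD)
    next
      case False
      show ?thesis
      proof (cases "t \<in> {a..b}")
        case True
        then have "(h has_derivative (\<lambda>_. 0)) (at t)"
          using der[of t] False by (simp add: has_vector_derivative_def)
        then obtain d where "d > 0" "\<forall>s. norm (s - t) < d \<longrightarrow> norm (h s - h t) \<le> \<epsilon> * norm (s - t)"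
          using \<open>\<epsilon> > 0\<close> unfolding has_derivative_at_alt by auto
        then show ?thesis
          using False by (intro exI[of _ d]) (auto simp: dist_norm norm_minus_commute)
      qed (use False in \<open>auto intro: exI[of _ 1]\<close>)
    qed
    then obtain d where d: "\<And>t. d t > 0" "\<And>t. t \<in> N \<Longrightarrow> ball t (d t) \<subseteq> O'"
      "\<And>t s. t \<notin> N \<Longrightarrow> t \<in> {a..b} \<Longrightarrow> s \<in> ball t (d t) \<Longrightarrow> norm (h s - h t) \<le> \<epsilon> * \<bar>s - t\<bar>"
      by metis
    have "gauge (\<lambda>t. ball t (d t))"
      using d(1) by (simp add: gauge_def)
    then obtain p where p: "p tagged_division_of {a..b}" "(\<lambda>t. ball t (d t)) fine p"
      using fine_division_exists_real by blast
    have cell: "K = {Inf K..Sup K} \<and> Inf K \<le> t \<and> t \<le> Sup K \<and> a \<le> Inf K \<and> Sup K \<le> b \<and>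
        t \<in> {a..b} \<and> K \<subseteq> ball t (d t)" if "(t, K) \<in> p" for t K
    proof -
      obtain u v where uv: "K = {u..v}"
        using p(1) \<open>(t, K) \<in> p\<close> by (metis box_real(2) tagged_division_ofD(4))
      have "t \<in> K" "K \<subseteq> {a..b}"
        using p(1) \<open>(t, K) \<in> p\<close> by (auto dest: tagged_division_ofD)
      moreover have "K \<subseteq> ball t (d t)"
        using p(2) \<open>(t, K) \<in> p\<close> by (auto simp: fine_def)
      ultimately show ?thesis
        using uv by auto
    qed
    have finp: "finite p"
      using p(1) by blast
    let ?inc = "\<lambda>K. norm (h (Sup K) - h (Inf K))"
    let ?pN = "{(t, K) \<in> p. t \<in> N}" and ?pG = "{(t, K) \<in> p. t \<notin> N}"
    have split: "p = ?pN \<union> ?pG" "?pN \<inter> ?pG = {}" "finite ?pN" "finite ?pG"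
      using finp by (auto intro: finite_subset[OF _ finp])
    have good: "(\<Sum>(t, K)\<in>?pG. ?inc K) \<le> \<epsilon> * (b - a)"
    proof -
      have "(\<Sum>(t, K)\<in>?pG. ?inc K) \<le> (\<Sum>(t, K)\<in>?pG. \<epsilon> * (Sup K - Inf K))"
      proof (rule sum_mono, clarify)
        fix t K assume tK: "(t, K) \<in> p" "t \<notin> N"
        note c = cell[OF tK(1)]
        then have "Sup K \<in> ball t (d t)" "Inf K \<in> ball t (d t)"
          by (metis atLeastAtMost_iff order_refl order_trans subsetD)+
        with d(3)[OF tK(2)] c
        have "norm (h (Sup K) - h t) \<le> \<epsilon> * (Sup K - t)" "norm (h (Inf K) - h t) \<le> \<epsilon> * (t - Inf K)"
          by fastforce+
        then have "norm ((h (Sup K) - h t) - (h (Inf K) - h t)) \<le> \<epsilon> * (Sup K - t) + \<epsilon> * (t - Inf K)"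
          by (rule order_trans[OF norm_triangle_ineq4 add_mono])
        then show "?inc K \<le> \<epsilon> * (Sup K - Inf K)"
          using c by (simp add: algebra_simps)
      qed
      also have "\<dots> \<le> (\<Sum>(t, K)\<in>p. \<epsilon> * (Sup K - Inf K))"
        using \<open>\<epsilon> > 0\<close> finp cell by (intro sum_mono2) force+
      also have "\<dots> = \<epsilon> * (b - a)"
        using additive_tagged_division_1[OF ab p(1), of "\<lambda>t. t"]
        by (simp add: sum_distrib_left[symmetric] case_prod_unfold)
      finally show ?thesis .
    qed
    have bad: "(\<Sum>(t, K)\<in>?pN. ?inc K) < \<epsilon>"
    proof -
      have tp: "?pN tagged_partial_division_of {a..b}"
        using p(1) by (auto simp: tagged_division_of_def intro: tagged_partial_division_subset)
      let ?D = "snd ` ?pN"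
      have D: "?D division_of \<Union>?D"
        using partial_division_of_tagged_division[OF tp] .
      have cellD: "K = {Inf K..Sup K}" "Inf K \<le> Sup K" "a \<le> Inf K" "Sup K \<le> b" "K \<subseteq> O'"
          "measure lebesgue K = Sup K - Inf K" if K: "K \<in> ?D" for K
      proof -
        obtain t where t: "(t, K) \<in> p" "t \<in> N"
          using K by auto
        note c = cell[OF t(1)]
        have len: "measure lebesgue {u..v} = v - u" if "u \<le> v" for u v :: real
          using that by simp
        have le: "Inf K \<le> Sup K"
          using c by linarith
        then have "measure lebesgue K = Sup K - Inf K"
          using len c by metis
        moreover have "K \<subseteq> O'"
          using c d(2)[OF t(2)] by blast
        ultimately show "K = {Inf K..Sup K}" "Inf K \<le> Sup K" "a \<le> Inf K" "Sup K \<le> b" "K \<subseteq> O'"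
          "measure lebesgue K = Sup K - Inf K"
          using c le by blast+
      qed
      have int: "interior K = {Inf K<..<Sup K}" if "K \<in> ?D" for K
      proof -
        have "K = {Inf K..Sup K}"
          by (rule cellD(1)[OF that])
        from arg_cong[OF this, of interior] show ?thesis
          by (simp only: interior_atLeastAtMost_real)
      qed
      have inj: "inj_on (\<lambda>K. (Inf K, Sup K)) ?D"
      proof (rule inj_onI)
        fix K K' assume K: "K \<in> ?D" "K' \<in> ?D" "(Inf K, Sup K) = (Inf K', Sup K')"
        have "K = {Inf K..Sup K}" "K' = {Inf K'..Sup K'}"
          by (rule cellD(1)[OF K(1)], rule cellD(1)[OF K(2)])
        then show "K = K'"
          using K(3) by simp
      qed
      \<comment> \<open>Several tags may share a degenerate cell, so passing from tagged cells to cells is harmless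
        only for a function that is 0 on every degenerate box. This includes the empty one, where
        \<open>Sup\<close> and \<open>Inf\<close> are unspecified and the value 0 has to be imposed.\<close>
      let ?jump = "\<lambda>K. if K = {} then 0 else ?inc K"
      have "(\<Sum>(t, K)\<in>?pN. ?inc K) = (\<Sum>(t, K)\<in>?pN. ?jump K)"
        using p(1) by (intro sum.cong) auto
      also have "\<dots> = sum ?jump ?D"
        by (rule sum.over_tagged_division_lemma[OF tagged_partial_division_of_Union_self[OF tp]])
          (auto simp: order_le_less)
      also have "\<dots> = sum ?inc ?D"
        using division_ofD(3)[OF D] by (intro sum.cong) auto
      also have "\<dots> = (\<Sum>(s, t)\<in>(\<lambda>K. (Inf K, Sup K)) ` ?D. norm (h t - h s))"
        by (simp add: sum.reindex[OF inj])
      also have "\<dots> < \<epsilon>"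
      proof (rule \<delta>(2), intro conjI)
        show "finite ((\<lambda>K. (Inf K, Sup K)) ` ?D)"
          using split by simp
        show "\<forall>(s, t)\<in>(\<lambda>K. (Inf K, Sup K)) ` ?D. a \<le> s \<and> s \<le> t \<and> t \<le> b"
          using cellD(2-4) by blast
        show "pairwise (\<lambda>(s, t) (s', t'). disjnt {s<..<t} {s'<..<t'}) ((\<lambda>K. (Inf K, Sup K)) ` ?D)"
        proof (rule pairwiseI)
          fix q q' assume q: "q \<in> (\<lambda>K. (Inf K, Sup K)) ` ?D" "q' \<in> (\<lambda>K. (Inf K, Sup K)) ` ?D" "q \<noteq> q'"
          obtain K where K: "K \<in> ?D" "q = (Inf K, Sup K)"
            using q(1) by auto
          obtain K' where K': "K' \<in> ?D" "q' = (Inf K', Sup K')"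
            using q(2) by auto
          have "K \<noteq> K'"
            using q(3) K(2) K'(2) by metis
          from division_ofD(5)[OF D K(1) K'(1) this]
          have "disjnt {Inf K<..<Sup K} {Inf K'<..<Sup K'}"
            unfolding disjnt_def int[OF K(1)] int[OF K'(1)] .
          then show "(\<lambda>(s, t) (s', t'). disjnt {s<..<t} {s'<..<t'}) q q'"
            by (simp only: K(2) K'(2) prod.case)
        qed
        have "(\<Sum>(s, t)\<in>(\<lambda>K. (Inf K, Sup K)) ` ?D. t - s) = (\<Sum>K\<in>?D. measure lebesgue K)"
        proof -
          have "(\<Sum>(s, t)\<in>(\<lambda>K. (Inf K, Sup K)) ` ?D. t - s) = (\<Sum>K\<in>?D. Sup K - Inf K)"
            by (simp add: sum.reindex[OF inj])
          also have "\<dots> = (\<Sum>K\<in>?D. measure lebesgue K)"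
            by (intro sum.cong) (simp_all only: cellD(6))
          finally show ?thesis .
        qed
        also have "\<dots> = measure lebesgue (\<Union>?D)"
          by (rule content_division[OF D])
        also have "\<dots> \<le> measure lebesgue O'"
          using cellD(5) lmeasurable_division[OF D] Olm
          by (intro measure_mono_fmeasurable) (blast intro: fmeasurableD)+
        also note mO
        finally show "(\<Sum>(s, t)\<in>(\<lambda>K. (Inf K, Sup K)) ` ?D. t - s) < \<delta>" .
      qed
      finally show ?thesis .
    qed
    have "norm (h b - h a) = norm (\<Sum>(t, K)\<in>p. h (Sup K) - h (Inf K))"
      using additive_tagged_division_1[OF ab p(1), of h] by simp
    also have "\<dots> \<le> (\<Sum>(t, K)\<in>p. ?inc K)"
      by (rule order_trans[OF norm_sum]) (simp add: case_prod_unfold)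
    also have "\<dots> = (\<Sum>(t, K)\<in>?pN. ?inc K) + (\<Sum>(t, K)\<in>?pG. ?inc K)"
      using split by (metis (no_types, lifting) sum.union_disjoint)
    also have "\<dots> \<le> \<epsilon> + \<epsilon> * (b - a)"
      using good bad by simp
    also have "\<dots> = \<epsilon> * (b - a + 1)"
      by (simp add: algebra_simps)
    also have "\<dots> = \<eta>"
      using ab by (simp add: \<epsilon>_def)
    finally show ?thesis
      by simp
  qed
  then have "norm (h b - h a) \<le> 0"
    by (rule field_le_epsilon)
  then show ?thesis
    by simp
qed


section \<open>Conservation\<close>

text \<open>At almost every time the velocity is minus a Clarke subgradient, on which the differential of
  \<open>C\<close> vanishes; so \<open>C\<close> has derivative zero along the trajectory.\<close>

lemma clarke_trajectory_C_map_const: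
  assumes G: "lie_subgroup G" and inv: "\<forall>g\<in>topspace G. \<forall>x. f (g *v x) = f x"
    and x: "clarke_trajectory f x" and st: "0 \<le> s" "s \<le> t"
  shows "C_map G (x t) = C_map G (x s)"
proof -
  have "abs_continuous_on s t x"
    using x st abs_continuous_on_subinterval[of 0 t x s t] by (auto simp: clarke_trajectory_def)
  then have ac: "abs_continuous_on s t (\<lambda>\<tau>. C_map G (x \<tau>))"
    unfolding C_map_eq_polar by (rule abs_continuous_on_quadratic[OF bounded_bilinear_polar_C[OF G]])
  have "AE \<tau> in lebesgue. \<tau> > 0 \<longrightarrow>
      (\<exists>x'. (x has_vector_derivative x') (at \<tau>) \<and> x' \<in> uminus ` clarke_subdiff f (x \<tau>))"
    using x by (simp add: clarke_trajectory_def)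
  then obtain N where N: "N \<in> null_sets lebesgue" and sol: "\<And>\<tau>. \<tau> \<notin> N \<Longrightarrow> \<tau> > 0 \<Longrightarrow>
      \<exists>x'. (x has_vector_derivative x') (at \<tau>) \<and> x' \<in> uminus ` clarke_subdiff f (x \<tau>)"
    unfolding eventually_ae_filter by (auto simp: subset_iff) metis
  show ?thesis
  proof (rule abs_continuous_on_derivative_zero_AE_imp_eq[OF st(2) ac])
    \<comment> \<open>The differential inclusion says nothing at the initial time.\<close>
    show "negligible (insert 0 N)"
      using N by (simp add: negligible_iff_null_sets[symmetric])
    fix \<tau> assume \<tau>: "\<tau> \<in> {s..t} - insert 0 N"
    then obtain v where v: "v \<in> clarke_subdiff f (x \<tau>)" "(x has_vector_derivative - v) (at \<tau>)"
      using sol[of \<tau>] st(1) by auto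
    interpret bounded_bilinear "polar_C G"
      by (rule bounded_bilinear_polar_C[OF G])
    have "((\<lambda>\<tau>. polar_C G (x \<tau>) (x \<tau>)) has_vector_derivative
        polar_C G (x \<tau>) (- v) + polar_C G (- v) (x \<tau>)) (at \<tau>)"
      by (intro has_vector_derivative v)
    moreover have "polar_C G (x \<tau>) (- v) + polar_C G (- v) (x \<tau>) = 0"
      using clarke_subdiff_cross_term_eq_0[OF G inv v(1)]
      by (simp add: minus_left minus_right) (metis add.inverse_unique add.commute neg_eq_iff_add_eq_0)
    ultimately show "((\<lambda>\<tau>. C_map G (x \<tau>)) has_vector_derivative 0) (at \<tau>)"
      by (simp add: C_map_eq_polar)
  qed
qed

theorem corollary1:
  fixes G :: "(real ^ 'n ^ 'n) topology"
    and f :: "real ^ 'n \<Rightarrow> ereal"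
    and xbar :: "real ^ 'n"
  assumes "lie_subgroup G"
    and "\<forall>x. f x \<noteq> -\<infinity>"
    and "\<forall>g\<in>topspace G. \<forall>x. f (g *v x) = f x"
    and "xbar \<in> edom f"
    and "(free_at G xbar \<or> typical_at G xbar) \<or>
         ((lipschitz_near f xbar \<and> xbar \<in> interior (edom f)) \<or> regular_fun_at f xbar)"
  shows "(\<exists>U. open U \<and> xbar \<in> U \<and>
           (\<forall>x\<in>U \<inter> dom_subdiff f. \<forall>v\<in>clarke_subdiff f x. \<forall>\<alpha>::real.
              C_map G (x + \<alpha> *\<^sub>R v) = C_map G x + \<alpha>\<^sup>2 *\<^sub>R C_map G v \<and>
              C_map G differentiable (at x) \<and> frechet_derivative (C_map G) (at x) v = 0)) \<and>
         (\<exists>U. open U \<and> xbar \<in> U \<and>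
           (\<forall>x. clarke_trajectory f x \<longrightarrow>
              (\<forall>J. is_interval J \<and> J \<subseteq> {0..} \<and> x ` J \<subseteq> U \<longrightarrow>
                 (\<forall>s\<in>J. \<forall>t\<in>J. C_map G (x s) = C_map G (x t)))))"
proof (intro conjI)
  note G = assms(1) and inv = assms(3)
  interpret bounded_bilinear "polar_C G"
    by (rule bounded_bilinear_polar_C[OF G])
  have pointwise: "C_map G (x + \<alpha> *\<^sub>R v) = C_map G x + \<alpha>\<^sup>2 *\<^sub>R C_map G v \<and>
      C_map G differentiable (at x) \<and> frechet_derivative (C_map G) (at x) v = 0"
    if v: "v \<in> clarke_subdiff f x" for x v and \<alpha> :: real
  proof (intro conjI)
    have cross: "polar_C G x v + polar_C G v x = 0"
      by (rule clarke_subdiff_cross_term_eq_0[OF G inv v])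
    have "C_map G (x + \<alpha> *\<^sub>R v) =
        C_map G x + \<alpha> *\<^sub>R (polar_C G x v + polar_C G v x) + \<alpha>\<^sup>2 *\<^sub>R C_map G v"
      by (simp add: C_map_eq_polar add_left add_right scaleR_left scaleR_right
          scaleR_add_right power2_eq_square)
    then show "C_map G (x + \<alpha> *\<^sub>R v) = C_map G x + \<alpha>\<^sup>2 *\<^sub>R C_map G v"
      by (simp add: cross)
    show "C_map G differentiable (at x)"
      using C_map_has_derivative[OF G] by (auto simp: differentiable_def)
    show "frechet_derivative (C_map G) (at x) v = 0"
      using frechet_derivative_at[OF C_map_has_derivative[OF G, of x]] cross by metis
  qed
  show "\<exists>U. open U \<and> xbar \<in> U \<and>
      (\<forall>x\<in>U \<inter> dom_subdiff f. \<forall>v\<in>clarke_subdiff f x. \<forall>\<alpha>::real.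
         C_map G (x + \<alpha> *\<^sub>R v) = C_map G x + \<alpha>\<^sup>2 *\<^sub>R C_map G v \<and>
         C_map G differentiable (at x) \<and> frechet_derivative (C_map G) (at x) v = 0)"
    using pointwise by (intro exI[of _ UNIV]) auto
  have const: "C_map G (x s) = C_map G (x t)"
    if "clarke_trajectory f x" "0 \<le> s" "0 \<le> t" for x s t
    using clarke_trajectory_C_map_const[OF G inv that(1)] that(2,3) by (metis linear)
  show "\<exists>U. open U \<and> xbar \<in> U \<and>
      (\<forall>x. clarke_trajectory f x \<longrightarrow>
         (\<forall>J. is_interval J \<and> J \<subseteq> {0..} \<and> x ` J \<subseteq> U \<longrightarrow>
            (\<forall>s\<in>J. \<forall>t\<in>J. C_map G (x s) = C_map G (x t))))"
    using const by (intro exI[of _ UNIV]) (auto simp: subset_iff)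
qed

end
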